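(* Let $X$ be a fixed $n\times n$ matrix and let $\Omega$ be drawn from the Bernoulli model with parameter $p\in(0,1]$. There is a numerical constant $C_0$ such that for each $\beta>2$, provided $np\ge\beta\log n$, $$p^{-1}\,\|(\mathcal{P}_\Omega-p\mathcal{I})(X)\|\le C_0\Big(\frac{\beta n\log n}{p}\Big)^{1/2}\|X\|_\infty$$ with probability at least $1-n^{-\beta}$.
   Context: Bernoulli model: $\{\delta_{ab}\}_{1\le a,b\le n}$ are i.i.d. $0/1$ variables with $\mathbb{P}(\delta_{ab}=1)=p$, $\Omega=\{(a,b):\delta_{ab}=1\}$; $\mathcal{P}_\Omega(X)$ keeps the entries of $X$ in $\Omega$ and zeroes the others; $\mathcal{I}$ is the identity, so $(\mathcal{P}_\Omega-p\mathcal{I})(X)=\mathcal{P}_\Omega(X)-pX$. $\|\cdot\|$ is the spectral norm and $\|X\|_\infty=\max_{ab}|X_{ab}|$. *)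

theory Defs
  imports "HOL-Probability.Probability"
begin

text \<open>An n x n real matrix is represented as a function nat => nat => real,
  of which only the entries with indices below n matter.\<close>

definition spec_norm :: "nat \<Rightarrow> (nat \<Rightarrow> nat \<Rightarrow> real) \<Rightarrow> real" where
  "spec_norm n A = (SUP x \<in> {x :: nat \<Rightarrow> real. (\<Sum>j<n. (x j)\<^sup>2) \<le> 1}.
      sqrt (\<Sum>i<n. (\<Sum>j<n. A i j * x j)\<^sup>2))"

definition max_norm :: "nat \<Rightarrow> (nat \<Rightarrow> nat \<Rightarrow> real) \<Rightarrow> real" where
  "max_norm n A = Max {\<bar>A i j\<bar> | i j. i < n \<and> j < n}"

definition bernoulli_model :: "nat \<Rightarrow> real \<Rightarrow> (nat \<times> nat \<Rightarrow> bool) pmf" where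
  "bernoulli_model n p = Pi_pmf ({..<n} \<times> {..<n}) False (\<lambda>_. bernoulli_pmf p)"

definition P_Omega :: "(nat \<times> nat \<Rightarrow> bool) \<Rightarrow> (nat \<Rightarrow> nat \<Rightarrow> real) \<Rightarrow> (nat \<Rightarrow> nat \<Rightarrow> real)" where
  "P_Omega \<delta> X = (\<lambda>a b. if \<delta> (a, b) then X a b else 0)"

end

theory Submission
  imports Defs
begin

text \<open>
  Moment method. With \<open>Z = P_Omega(X) - p X\<close> and alternating products
  \<open>P = \<dots> Z Z\<^sup>T Z\<close> of \<open>m\<close> factors, log-convexity of the norms of the iterates of a
  unit vector gives \<open>\<parallel>Z\<parallel>\<^sup>m \<le> \<parallel>P\<parallel>\<close>, which is at most the Frobenius norm of \<open>P\<close>. The expected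
  square of the latter is a sum over pairs of walks of length \<open>m\<close> with a common origin. Entries
  are independent and centered, so only pairs using every edge at least twice contribute; such a
  pair has \<open>d \<le> m\<close> distinct edges and contributes at most
  \<open>\<parallel>X\<parallel>\<^sub>\<infinity>\<^bsup>2m\<^esup> p\<^sup>d \<le> \<parallel>X\<parallel>\<^sub>\<infinity>\<^bsup>2m\<^esup> (np/m)\<^sup>m (m/n)\<^sup>d\<close> when \<open>m \<le> np\<close>. With the weight \<open>(m/n)\<^sup>d\<close> the
  constraint on the walks can be dropped: each step either opens a new edge (\<open>n\<close> choices of weight
  \<open>m/n\<close>) or repeats one of at most \<open>2m\<close> old ones, a factor of at most \<open>3m\<close>. This bounds the moment
  by \<open>n (9 n p m \<parallel>X\<parallel>\<^sub>\<infinity>\<^sup>2)\<^sup>m\<close>, and Markov's inequality with \<open>m = \<lfloor>\<beta> log n\<rfloor>\<close> finishes the proof.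
\<close>

section \<open>Bounding the spectral norm through alternating products\<close>

text \<open>Log-convexity makes the ratios \<open>a (Suc m) / a m\<close> nondecreasing, and
  \<open>a 0 \<le> 1\<close> makes the first one at least \<open>a 1\<close>. The inner fact
  \<open>step\<close> expresses this without division, so vanishing terms do no harm.\<close>

lemma log_convex_power_le:
  fixes a :: "nat \<Rightarrow> real"
  assumes nonneg: "\<And>m. 0 \<le> a m" and a0: "a 0 \<le> 1"
    and log_convex: "\<And>m. (a (Suc m))\<^sup>2 \<le> a m * a (Suc (Suc m))"
  shows "a 1 ^ Suc m \<le> a (Suc m)"
proof -
  have step: "a 1 * a m \<le> a (Suc m)" for m
  proof (induction m)
    case 0
    show ?case using mult_left_mono[OF a0 nonneg[of 1]] by simp
  next
    case (Suc m)
    show ?case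
    proof (cases "a (Suc m) = 0")
      case True
      then show ?thesis using nonneg by simp
    next
      case False
      then have pos: "0 < a (Suc m)" using nonneg[of "Suc m"] by simp
      have "a 1 * (a (Suc m))\<^sup>2 \<le> a 1 * (a m * a (Suc (Suc m)))"
        by (intro mult_left_mono log_convex nonneg)
      also have "\<dots> \<le> a (Suc m) * a (Suc (Suc m))"
        using mult_right_mono[OF Suc nonneg[of "Suc (Suc m)"]] by (simp add: mult.assoc)
      finally have "a (Suc m) * (a 1 * a (Suc m)) \<le> a (Suc m) * a (Suc (Suc m))"
        by (simp add: power2_eq_square mult_ac)
      then show ?thesis using pos by (simp only: mult_le_cancel_left_pos)
    qed
  qed
  show ?thesis
  proof (induction m)
    case (Suc m)
    have "a 1 ^ Suc (Suc m) \<le> a 1 * a (Suc m)"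
      using mult_left_mono[OF Suc nonneg[of 1]] by simp
    then show ?case using step[of "Suc m"] by simp
  qed simp
qed

text \<open>The side flag \<open>s\<close> tells whether the current vertex \<open>u\<close> is a row or a column index.\<close>

definition edge :: "bool \<Rightarrow> nat \<Rightarrow> nat \<Rightarrow> nat \<times> nat" where
  "edge s u v = (if s then (u, v) else (v, u))"

lemma edge_Not: "edge (\<not> s) u v = edge s v u"
  by (simp add: edge_def)

text \<open>Entries of an alternating product of \<open>m\<close> factors: the leftmost is
  \<open>Z\<close> if \<open>s\<close> holds and its transpose otherwise.\<close>

fun alt_power :: "nat \<Rightarrow> (nat \<times> nat \<Rightarrow> real) \<Rightarrow> nat \<Rightarrow> bool \<Rightarrow> nat \<Rightarrow> nat \<Rightarrow> real" where
  "alt_power n Z 0 s u v = of_bool (u = v)"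
| "alt_power n Z (Suc m) s u v = (\<Sum>y<n. Z (edge s u y) * alt_power n Z m (\<not> s) y v)"

text \<open>The vectors x, Z x, Z^T Z x and so on. The rightmost factor is always \<open>Z\<close>,
  so the flag of the newest factor is determined by the parity of \<open>m\<close>.\<close>

fun alt_iterate :: "nat \<Rightarrow> (nat \<times> nat \<Rightarrow> real) \<Rightarrow> (nat \<Rightarrow> real) \<Rightarrow> nat \<Rightarrow> nat \<Rightarrow> real" where
  "alt_iterate n Z x 0 u = x u"
| "alt_iterate n Z x (Suc m) u = (\<Sum>y<n. Z (edge (even m) u y) * alt_iterate n Z x m y)"

lemma alt_iterate_eq_alt_power:
  "u < n \<Longrightarrow> alt_iterate n Z x m u = (\<Sum>v<n. alt_power n Z m (odd m) u v * x v)"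
proof (induction m arbitrary: u)
  case 0
  then show ?case by (simp add: sum.delta of_bool_def if_distrib[of "\<lambda>t. t * _"] cong: if_cong)
next
  case (Suc m)
  have "alt_iterate n Z x (Suc m) u =
      (\<Sum>y<n. Z (edge (even m) u y) * (\<Sum>v<n. alt_power n Z m (odd m) y v * x v))"
    using Suc.IH by simp
  also have "\<dots> = (\<Sum>v<n. (\<Sum>y<n. Z (edge (even m) u y) * alt_power n Z m (odd m) y v) * x v)"
    unfolding sum_distrib_left sum_distrib_right by (subst sum.swap) (simp add: mult_ac)
  finally show ?case by simp
qed

text \<open>Consecutive factors are transposes of each other: if c_(m+1) = W c_m, then c_(m+2) = W^T
  c_(m+1). Hence the squared norm of c_(m+1) is the inner product of c_m and c_(m+2), and
  Cauchy-Schwarz applies.\<close>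

lemma alt_iterate_log_convex:
  "(L2_set (alt_iterate n Z x (Suc m)) {..<n})\<^sup>2 \<le>
    L2_set (alt_iterate n Z x m) {..<n} * L2_set (alt_iterate n Z x (Suc (Suc m))) {..<n}"
proof -
  let ?c = "alt_iterate n Z x"
  have "(L2_set (?c (Suc m)) {..<n})\<^sup>2 = (\<Sum>u<n. ?c (Suc m) u * ?c (Suc m) u)"
    by (simp add: L2_set_def sum_nonneg power2_eq_square del: alt_iterate.simps)
  also have "\<dots> = (\<Sum>u<n. (\<Sum>y<n. Z (edge (even m) u y) * ?c m y) * ?c (Suc m) u)"
    by simp
  also have "\<dots> = (\<Sum>y<n. ?c m y * (\<Sum>u<n. Z (edge (odd m) y u) * ?c (Suc m) u))"
    unfolding sum_distrib_left sum_distrib_right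
    by (subst sum.swap) (simp add: mult_ac edge_Not del: alt_iterate.simps)
  also have "\<dots> = (\<Sum>y<n. ?c m y * ?c (Suc (Suc m)) y)"
    by simp
  also have "\<dots> \<le> (\<Sum>y<n. \<bar>?c m y\<bar> * \<bar>?c (Suc (Suc m)) y\<bar>)"
    by (intro sum_mono) (metis abs_ge_self abs_mult)
  also have "\<dots> \<le> L2_set (?c m) {..<n} * L2_set (?c (Suc (Suc m))) {..<n}"
    by (rule L2_set_mult_ineq)
  finally show ?thesis .
qed

text \<open>The squared norm, hence a polynomial in the entries of \<open>Z\<close>. The flag
  \<open>odd m\<close> is the one that makes the rightmost factor \<open>Z\<close>.\<close>

definition alt_frobenius :: "nat \<Rightarrow> nat \<Rightarrow> (nat \<times> nat \<Rightarrow> real) \<Rightarrow> real" where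
  "alt_frobenius n m Z = (\<Sum>u<n. \<Sum>v<n. (alt_power n Z m (odd m) u v)\<^sup>2)"

lemma alt_frobenius_nonneg: "0 \<le> alt_frobenius n m Z"
  by (simp add: alt_frobenius_def sum_nonneg)

lemma alt_iterate_le_frobenius:
  "(L2_set (alt_iterate n Z x m) {..<n})\<^sup>2 \<le> alt_frobenius n m Z * (\<Sum>j<n. (x j)\<^sup>2)"
proof -
  have "(L2_set (alt_iterate n Z x m) {..<n})\<^sup>2 = (\<Sum>u<n. (\<Sum>v<n. alt_power n Z m (odd m) u v * x v)\<^sup>2)"
    by (simp add: L2_set_def sum_nonneg alt_iterate_eq_alt_power)
  also have "\<dots> \<le> (\<Sum>u<n. (\<Sum>v<n. (alt_power n Z m (odd m) u v)\<^sup>2) * (\<Sum>j<n. (x j)\<^sup>2))"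
    by (intro sum_mono Cauchy_Schwarz_ineq_sum)
  finally show ?thesis
    by (simp add: alt_frobenius_def sum_distrib_right)
qed

text \<open>For \<open>x\<close> in the unit ball and P the alternating product, |Z x|^m is at most
  |P x|, which is at most the Frobenius norm of P and so at most \<open>r ^ m\<close>. Taking roots
  bounds |Z x|.\<close>

lemma spec_norm_le_of_alt_frobenius:
  assumes r: "0 \<le> r" and m: "0 < m" and F: "alt_frobenius n m Z \<le> (r\<^sup>2) ^ m"
  shows "spec_norm n (\<lambda>a b. Z (a, b)) \<le> r"
  unfolding spec_norm_def
proof (rule cSUP_least)
  show "{x :: nat \<Rightarrow> real. (\<Sum>j<n. (x j)\<^sup>2) \<le> 1} \<noteq> {}"
    by (auto intro!: exI[of _ "\<lambda>_. 0"])
next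
  fix x :: "nat \<Rightarrow> real"
  assume x: "x \<in> {x. (\<Sum>j<n. (x j)\<^sup>2) \<le> 1}"
  let ?a = "\<lambda>m. L2_set (alt_iterate n Z x m) {..<n}"
  obtain k where k: "m = Suc k" using m by (cases m) auto
  have a0: "?a 0 \<le> 1" using x by (simp add: L2_set_def)
  have "?a 1 ^ m \<le> ?a m"
    unfolding k
    by (rule log_convex_power_le[where a = ?a])
       (use a0 alt_iterate_log_convex in \<open>auto simp del: alt_iterate.simps\<close>)
  moreover have "(?a m)\<^sup>2 \<le> (r ^ m)\<^sup>2"
  proof -
    have "(?a m)\<^sup>2 \<le> alt_frobenius n m Z * (\<Sum>j<n. (x j)\<^sup>2)"
      by (rule alt_iterate_le_frobenius)
    also have "\<dots> \<le> alt_frobenius n m Z * 1"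
      using x by (intro mult_left_mono) (auto simp: alt_frobenius_nonneg)
    also have "\<dots> \<le> (r\<^sup>2) ^ m" using F by simp
    finally show ?thesis by (simp add: power_mult[symmetric] mult.commute)
  qed
  then have "?a m \<le> r ^ m"
    using r by (simp add: power2_le_iff_abs_le)
  ultimately have "?a 1 ^ m \<le> r ^ m" by linarith
  then have "?a 1 \<le> r"
    using power_le_imp_le_base[of "?a 1" k r] r unfolding k by simp
  then show "sqrt (\<Sum>i<n. (\<Sum>j<n. Z (i, j) * x j)\<^sup>2) \<le> r"
    by (simp add: L2_set_def edge_def)
qed

section \<open>Counting walks weighted by their number of distinct edges\<close>

text \<open>The origin is not stored: a walk is the list of its \<open>m\<close> later vertices, so
  one set serves every origin and either side.\<close>

definition walks :: "nat \<Rightarrow> nat \<Rightarrow> nat list set" where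
  "walks n m = {w. set w \<subseteq> {..<n} \<and> length w = m}"

lemma finite_walks [simp]: "finite (walks n m)"
  unfolding walks_def by (rule finite_lists_length_eq) simp

lemma walks_0 [simp]: "walks n 0 = {[]}"
  by (auto simp: walks_def)

lemma sum_walks_Suc:
  fixes f :: "nat list \<Rightarrow> 'a :: comm_monoid_add"
  shows "(\<Sum>w\<in>walks n (Suc m). f w) = (\<Sum>v<n. \<Sum>w\<in>walks n m. f (v # w))"
proof -
  have "walks n (Suc m) = (\<lambda>(v, w). v # w) ` ({..<n} \<times> walks n m)"
    by (auto simp: walks_def length_Suc_conv image_iff)
  then have "(\<Sum>w\<in>walks n (Suc m). f w) = (\<Sum>(v, w)\<in>{..<n} \<times> walks n m. f (v # w))"
    by (simp add: sum.reindex inj_on_def case_prod_beta)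
  then show ?thesis by (simp add: sum.cartesian_product)
qed

text \<open>Edges are matrix positions (row, column) whatever the direction of travel, so retracing
  a step repeats the same random variable.\<close>

fun walk_edges :: "bool \<Rightarrow> nat \<Rightarrow> nat list \<Rightarrow> (nat \<times> nat) list" where
  "walk_edges s u [] = []"
| "walk_edges s u (v # w) = edge s u v # walk_edges (\<not> s) v w"

lemma length_walk_edges [simp]: "length (walk_edges s u w) = length w"
  by (induction w arbitrary: s u) auto

lemma set_walk_edges:
  "u < n \<Longrightarrow> set w \<subseteq> {..<n} \<Longrightarrow> set (walk_edges s u w) \<subseteq> {..<n} \<times> {..<n}"
  by (induction w arbitrary: s u) (auto simp: edge_def)

lemma alt_power_eq_sum_walks:
  "alt_power n Z m s u v =
    (\<Sum>w\<in>walks n m. of_bool (last (u # w) = v) * prod_list (map Z (walk_edges s u w)))"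
proof (induction m arbitrary: s u)
  case (Suc m)
  show ?case
    unfolding alt_power.simps sum_walks_Suc Suc.IH sum_distrib_left
    by (intro sum.cong refl) simp
qed simp

text \<open>A step along a new edge costs one more factor \<open>x\<close>, with at most
  \<open>n\<close> choices. Steps along an old edge number at most \<open>card E\<close>, because
  \<open>edge s u\<close> is injective.\<close>

lemma sum_power_insert_edge_le:
  fixes x :: real
  assumes x: "0 \<le> x" and E: "finite E"
  shows "(\<Sum>v<n. x ^ card (insert (edge s u v) E)) \<le> (n * x + card E) * x ^ card E"
proof -
  let ?old = "{v \<in> {..<n}. edge s u v \<in> E}"
  have "card ?old \<le> card E"
    by (rule card_inj_on_le[where f = "edge s u"]) (use E in \<open>auto simp: inj_on_def edge_def split: if_splits\<close>)
  have "(\<Sum>v<n. x ^ card (insert (edge s u v) E))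
      \<le> (\<Sum>v<n. x * x ^ card E + of_bool (edge s u v \<in> E) * x ^ card E)"
    using x E by (intro sum_mono) (auto simp: insert_absorb)
  also have "\<dots> = n * (x * x ^ card E) + (\<Sum>v<n. of_bool (edge s u v \<in> E)) * x ^ card E"
    by (simp add: sum.distrib sum_distrib_right)
  also have "(\<Sum>v<n. of_bool (edge s u v \<in> E)) = real (card ?old)"
    by (simp add: of_bool_def sum.If_cases Int_def)
  also have "n * (x * x ^ card E) + card ?old * x ^ card E
      \<le> n * (x * x ^ card E) + card E * x ^ card E"
    using \<open>card ?old \<le> card E\<close> x by (intro add_left_mono mult_right_mono) auto
  finally show ?thesis by (simp add: algebra_simps)
qed

text \<open>Induction over the steps, with \<open>E\<close> the edges already used. The invariant
  \<open>card E + m \<le> K\<close> survives because each step adds at most one edge, so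
  \<open>K\<close> bounds the number of old edges throughout.\<close>

lemma sum_walks_power_card_le:
  fixes x :: real
  assumes x: "0 \<le> x"
  shows "finite E \<Longrightarrow> card E + m \<le> K \<Longrightarrow>
    (\<Sum>w\<in>walks n m. x ^ card (E \<union> set (walk_edges s u w))) \<le> (n * x + K) ^ m * x ^ card E"
proof (induction m arbitrary: E s u)
  case (Suc m)
  have "(\<Sum>w\<in>walks n (Suc m). x ^ card (E \<union> set (walk_edges s u w)))
      = (\<Sum>v<n. \<Sum>w\<in>walks n m. x ^ card (insert (edge s u v) E \<union> set (walk_edges (\<not> s) v w)))"
    by (simp add: sum_walks_Suc)
  also have "\<dots> \<le> (\<Sum>v<n. (n * x + K) ^ m * x ^ card (insert (edge s u v) E))"
  proof (intro sum_mono Suc.IH)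
    fix v
    show "card (insert (edge s u v) E) + m \<le> K"
      using Suc.prems card_insert_le_m1[of "Suc (card E)" E "edge s u v"] by simp
  qed (use Suc.prems in simp)
  also have "\<dots> \<le> (n * x + K) ^ m * ((n * x + card E) * x ^ card E)"
    unfolding sum_distrib_left[symmetric]
    using x Suc.prems by (intro mult_left_mono sum_power_insert_edge_le) auto
  also have "\<dots> \<le> (n * x + K) ^ m * ((n * x + K) * x ^ card E)"
    using x Suc.prems by (intro mult_left_mono mult_right_mono) auto
  finally show ?case by (simp add: mult_ac)
qed simp

text \<open>The second walk is summed first, with the edges of the first walk as \<open>E\<close>;
  then the first walk is summed with \<open>E\<close> empty. Both sums use
  \<open>K = 2 * m\<close>.\<close>

lemma sum_walk_pairs_power_card_le:
  fixes x :: real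
  assumes x: "0 \<le> x"
  shows "(\<Sum>w\<in>walks n m. \<Sum>w'\<in>walks n m. x ^ card (set (walk_edges s u w @ walk_edges s u w')))
    \<le> (n * x + real (2 * m)) ^ (2 * m)"
proof -
  let ?B = "n * x + real (2 * m)"
  have "(\<Sum>w\<in>walks n m. \<Sum>w'\<in>walks n m. x ^ card (set (walk_edges s u w @ walk_edges s u w')))
      \<le> (\<Sum>w\<in>walks n m. ?B ^ m * x ^ card ({} \<union> set (walk_edges s u w)))"
    unfolding set_append
  proof (intro sum_mono)
    fix w assume "w \<in> walks n m"
    then have "card (set (walk_edges s u w)) \<le> m"
      using card_length[of "walk_edges s u w"] by (simp add: walks_def)
    then show "(\<Sum>w'\<in>walks n m. x ^ card (set (walk_edges s u w) \<union> set (walk_edges s u w')))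
        \<le> ?B ^ m * x ^ card ({} \<union> set (walk_edges s u w))"
      using sum_walks_power_card_le[OF x, where E = "set (walk_edges s u w)" and m = m and K = "2 * m"] by simp
  qed
  also have "\<dots> \<le> ?B ^ m * (?B ^ m * x ^ card ({} :: (nat \<times> nat) set))"
    unfolding sum_distrib_left[symmetric]
    using x by (intro mult_left_mono sum_walks_power_card_le) auto
  finally show ?thesis by (simp only: power_add mult_2 card.empty power_0 mult_1_right)
qed

section \<open>Moments of products of centered Bernoulli variables\<close>

lemma prod_list_map_eq_prod_count:
  fixes f :: "'a \<Rightarrow> 'b :: comm_monoid_mult"
  assumes "finite A"
  shows "set xs \<subseteq> A \<Longrightarrow> prod_list (map f xs) = (\<Prod>x\<in>A. f x ^ count_list xs x)"
proof (induction xs)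
  case (Cons y xs)
  have "(\<Prod>x\<in>A. f x ^ count_list (y # xs) x) = (\<Prod>x\<in>A. (if x = y then f x else 1) * f x ^ count_list xs x)"
    by (intro prod.cong) auto
  also have "\<dots> = f y * prod_list (map f xs)"
    using Cons assms by (simp add: prod.distrib prod.delta)
  finally show ?case by simp
qed simp

text \<open>The coordinates of \<open>Pi_pmf\<close> are independent; finiteness of the value type
  supplies the integrability that the product rule asks for.\<close>

lemma expectation_prod_Pi_pmf_finite:
  fixes f :: "'a \<Rightarrow> 'b :: finite \<Rightarrow> real"
  assumes "finite A"
  shows "measure_pmf.expectation (Pi_pmf A dflt q) (\<lambda>h. \<Prod>x\<in>A. f x (h x))
    = (\<Prod>x\<in>A. measure_pmf.expectation (q x) (f x))"
proof -
  have int: "integrable (measure_pmf P) g" for P :: "'b pmf" and g :: "'b \<Rightarrow> real"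
    by (intro integrable_measure_pmf_finite) simp
  have marginal: "map_pmf (\<lambda>h. h x) (Pi_pmf A dflt q) = q x" if "x \<in> A" for x
    using Pi_pmf_component[OF assms, of x dflt q] that by simp
  have "prob_space.indep_vars (Pi_pmf A dflt q) (\<lambda>_. borel) (\<lambda>x h. f x (h x)) A"
    by (rule prob_space.indep_vars_compose2[OF measure_pmf.prob_space_axioms, OF indep_vars_Pi_pmf[OF assms]]) simp
  moreover have "integrable (measure_pmf (Pi_pmf A dflt q)) (\<lambda>h. f x (h x))" if "x \<in> A" for x
    using int[of "q x" "f x"] by (simp flip: marginal[OF that])
  ultimately have "measure_pmf.expectation (Pi_pmf A dflt q) (\<lambda>h. \<Prod>x\<in>A. f x (h x))
      = (\<Prod>x\<in>A. measure_pmf.expectation (Pi_pmf A dflt q) (\<lambda>h. f x (h x)))"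
    using assms by (intro prob_space.indep_vars_lebesgue_integral[OF measure_pmf.prob_space_axioms]) auto
  also have "\<dots> = (\<Prod>x\<in>A. measure_pmf.expectation (q x) (f x))"
    by (intro prod.cong refl) (simp flip: marginal)
  finally show ?thesis .
qed

text \<open>The centered variable has absolute value at most 1, so for \<open>k \<ge> 2\<close> the
  moment is dominated by the variance \<open>p - p\<^sup>2\<close>.\<close>

lemma abs_centered_bernoulli_moment_le:
  fixes p :: real
  assumes p: "0 \<le> p" "p \<le> 1"
  shows "\<bar>measure_pmf.expectation (bernoulli_pmf p) (\<lambda>b. (of_bool b - p) ^ k)\<bar>
    \<le> (if k = 0 then 1 else if k = 1 then 0 else p)"
proof -
  consider "k = 0" | "k = 1" | "2 \<le> k" by linarith
  then show ?thesis
  proof cases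
    case 3
    have "\<bar>(1 - p) ^ k * p + (- p) ^ k * (1 - p)\<bar> \<le> (1 - p) ^ k * p + p ^ k * (1 - p)"
      using p by (intro order_trans[OF abs_triangle_ineq]) (simp add: abs_mult power_abs)
    also have "\<dots> \<le> (1 - p)\<^sup>2 * p + p\<^sup>2 * (1 - p)"
      using p 3 by (intro add_mono mult_right_mono power_decreasing) auto
    also have "\<dots> = p - p\<^sup>2"
      by (simp add: power2_eq_square algebra_simps)
    also have "\<dots> \<le> p" by simp
    finally show ?thesis using p 3 by simp
  qed (use p in \<open>simp_all add: algebra_simps\<close>)
qed

text \<open>Independence splits the expectation by edges. Multiplicities add up to
  \<open>length xs\<close>, so if \<open>2 * card (set xs)\<close> exceeds it, some edge occurs
  exactly once and its mean 0 kills the product. Otherwise each distinct edge contributes at most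
  \<open>p\<close>.\<close>

lemma abs_expectation_centered_prod_le:
  fixes p :: real
  assumes p: "0 \<le> p" "p \<le> 1" and A: "finite A" and xs: "set xs \<subseteq> A"
  shows "\<bar>measure_pmf.expectation (Pi_pmf A False (\<lambda>_. bernoulli_pmf p))
        (\<lambda>\<delta>. prod_list (map (\<lambda>e. of_bool (\<delta> e) - p) xs))\<bar>
    \<le> (if 2 * card (set xs) \<le> length xs then p ^ card (set xs) else 0)"
proof -
  let ?b = "\<lambda>k :: nat. if k = 0 then 1 else if k = 1 then 0 else p"
  have "\<bar>measure_pmf.expectation (Pi_pmf A False (\<lambda>_. bernoulli_pmf p))
        (\<lambda>\<delta>. prod_list (map (\<lambda>e. of_bool (\<delta> e) - p) xs))\<bar>
      = (\<Prod>e\<in>A. \<bar>measure_pmf.expectation (bernoulli_pmf p) (\<lambda>b. (of_bool b - p) ^ count_list xs e)\<bar>)"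
    unfolding prod_list_map_eq_prod_count[OF A xs] abs_prod[symmetric]
    by (subst expectation_prod_Pi_pmf_finite[OF A, where f = "\<lambda>e b. (of_bool b - p) ^ count_list xs e"]) simp
  also have "\<dots> \<le> (\<Prod>e\<in>A. ?b (count_list xs e))"
    using p by (intro prod_mono conjI abs_ge_zero abs_centered_bernoulli_moment_le)
  also have "\<dots> = (\<Prod>e\<in>set xs. ?b (count_list xs e))"
    using A xs by (intro prod.mono_neutral_right) (auto simp: count_list_0_iff)
  also have "\<dots> \<le> (if 2 * card (set xs) \<le> length xs then p ^ card (set xs) else 0)"
  proof (cases "2 * card (set xs) \<le> length xs")
    case True
    have "(\<Prod>e\<in>set xs. ?b (count_list xs e)) \<le> (\<Prod>e\<in>set xs. p)"
      using p by (intro prod_mono) (auto simp: count_list_0_iff)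
    then show ?thesis using True by simp
  next
    case False
    have "\<exists>e\<in>set xs. count_list xs e < 2"
    proof (rule ccontr)
      assume "\<not> ?thesis"
      then have "(\<Sum>e\<in>set xs. 2) \<le> (\<Sum>e\<in>set xs. count_list xs e)"
        by (intro sum_mono) auto
      then show False using False by (simp add: sum_count_set)
    qed
    then obtain e where "e \<in> set xs" "count_list xs e < 2" by blast
    then have "?b (count_list xs e) = 0"
      using count_list_0_iff[of xs e] by auto
    then have "(\<Prod>e\<in>set xs. ?b (count_list xs e)) = 0"
      using \<open>e \<in> set xs\<close> by (intro prod_zero[OF finite_set] bexI)
    then show ?thesis unfolding if_not_P[OF False] by linarith
  qed
  finally show ?thesis .
qed

lemma integrable_bernoulli_model [simp]:
  fixes f :: "_ \<Rightarrow> real"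
  shows "integrable (measure_pmf (bernoulli_model n p)) f"
proof (rule integrable_measure_pmf_finite)
  have "finite (PiE_dflt ({..<n} \<times> {..<n}) False (\<lambda>_. set_pmf (bernoulli_pmf p)))"
    by (intro finite_PiE_dflt) auto
  then show "finite (set_pmf (bernoulli_model n p))"
    unfolding bernoulli_model_def
    by (rule rev_finite_subset) (use set_Pi_pmf_subset'[of "{..<n} \<times> {..<n}"] in \<open>simp add: comp_def\<close>)
qed

lemma prod_list_map_mult:
  fixes f g :: "'a \<Rightarrow> 'b :: comm_monoid_mult"
  shows "prod_list (map (\<lambda>e. f e * g e) xs) = prod_list (map f xs) * prod_list (map g xs)"
  by (induction xs) (auto simp: mult_ac)

lemma abs_prod_list_le_power:
  fixes f :: "'a \<Rightarrow> real"
  assumes "\<And>e. e \<in> set xs \<Longrightarrow> \<bar>f e\<bar> \<le> B"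
  shows "\<bar>prod_list (map f xs)\<bar> \<le> B ^ length xs"
  using assms
proof (induction xs)
  case (Cons e xs)
  have "0 \<le> B" using Cons.prems[of e] by simp
  then show ?case
    using Cons by (auto simp: abs_mult intro!: mult_mono)
qed simp

text \<open>
  The factor \<open>(n * p / m) ^ m\<close> is independent of the walks, and \<open>m / n\<close> is the weight for which
  new and old edges are balanced in the walk count.
\<close>

lemma abs_expectation_walk_pair_le:
  fixes p B :: real
  assumes p: "0 < p" "p \<le> 1" and m: "0 < m" "m \<le> n * p" and n: "0 < n"
    and X: "\<And>i j. i < n \<Longrightarrow> j < n \<Longrightarrow> \<bar>X i j\<bar> \<le> B"
    and xs: "set xs \<subseteq> {..<n} \<times> {..<n}" "length xs = 2 * m"
  shows "\<bar>measure_pmf.expectation (bernoulli_model n p)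
        (\<lambda>\<delta>. prod_list (map (\<lambda>e. (of_bool (\<delta> e) - p) * X (fst e) (snd e)) xs))\<bar>
    \<le> B ^ (2 * m) * (n * p / m) ^ m * (m / n) ^ card (set xs)"
proof -
  let ?d = "card (set xs)"
  have B: "0 \<le> B" using X[of 0 0] n by simp
  have "\<bar>measure_pmf.expectation (bernoulli_model n p)
        (\<lambda>\<delta>. prod_list (map (\<lambda>e. (of_bool (\<delta> e) - p) * X (fst e) (snd e)) xs))\<bar>
      = \<bar>measure_pmf.expectation (bernoulli_model n p) (\<lambda>\<delta>. prod_list (map (\<lambda>e. of_bool (\<delta> e) - p) xs))\<bar>
        * \<bar>prod_list (map (\<lambda>e. X (fst e) (snd e)) xs)\<bar>"
    by (simp add: prod_list_map_mult abs_mult)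
  also have "\<dots> \<le> (if 2 * ?d \<le> 2 * m then p ^ ?d else 0) * B ^ (2 * m)"
  proof (rule mult_mono)
    show "\<bar>prod_list (map (\<lambda>e. X (fst e) (snd e)) xs)\<bar> \<le> B ^ (2 * m)"
      unfolding xs(2)[symmetric] by (rule abs_prod_list_le_power) (use xs X in auto)
    show "\<bar>measure_pmf.expectation (bernoulli_model n p) (\<lambda>\<delta>. prod_list (map (\<lambda>e. of_bool (\<delta> e) - p) xs))\<bar>
        \<le> (if 2 * ?d \<le> 2 * m then p ^ ?d else 0)"
      unfolding bernoulli_model_def xs(2)[symmetric]
      by (rule abs_expectation_centered_prod_le) (use p xs in auto)
  qed (use p in auto)
  also have "\<dots> \<le> ((n * p / m) ^ m * (m / n) ^ ?d) * B ^ (2 * m)"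
  proof (rule mult_right_mono)
    \<comment> \<open>The assumption \<open>m \<le> n * p\<close> enters here: once \<open>p\<close>
      is written as \<open>(n * p / m) * (m / n)\<close>, a base of at least 1 lets the exponent
      \<open>?d\<close> of the first factor grow to \<open>m\<close>.\<close>
    have ge1: "1 \<le> n * p / m" using m by (simp add: field_simps)
    show "(if 2 * ?d \<le> 2 * m then p ^ ?d else 0) \<le> (n * p / m) ^ m * (m / n) ^ ?d"
    proof (cases "?d \<le> m")
      case True
      have "p ^ ?d = (n * p / m) ^ ?d * (m / n) ^ ?d"
        using m n by (simp add: power_mult_distrib[symmetric])
      also have "\<dots> \<le> (n * p / m) ^ m * (m / n) ^ ?d"
        using ge1 True by (intro mult_right_mono power_increasing) auto
      finally show ?thesis using True by simp
    qed (use p in auto)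
  qed (use B in auto)
  finally show ?thesis by (simp add: mult_ac)
qed

section \<open>Expected Frobenius norm of the alternating product\<close>

text \<open>Squaring an entry yields pairs of walks sharing both ends. Their edge lists are appended
  so that the moment bound for a single list applies.\<close>

lemma alt_frobenius_eq_sum_walk_pairs:
  "alt_frobenius n m Z = (\<Sum>u<n. \<Sum>v<n. \<Sum>w\<in>walks n m. \<Sum>w'\<in>walks n m.
     of_bool (last (u # w) = v \<and> last (u # w') = v) *
     prod_list (map Z (walk_edges (odd m) u w @ walk_edges (odd m) u w')))"
  unfolding alt_frobenius_def alt_power_eq_sum_walks power2_eq_square sum_product
  by (intro sum.cong refl) (simp add: of_bool_conj mult_ac del: last.simps)

lemma expectation_alt_frobenius_le:
  fixes p B :: real
  assumes p: "0 < p" "p \<le> 1" and m: "0 < m" "m \<le> n * p" and n: "0 < n"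
    and X: "\<And>i j. i < n \<Longrightarrow> j < n \<Longrightarrow> \<bar>X i j\<bar> \<le> B"
  shows "measure_pmf.expectation (bernoulli_model n p)
        (\<lambda>\<delta>. alt_frobenius n m (\<lambda>e. (of_bool (\<delta> e) - p) * X (fst e) (snd e)))
    \<le> n * (9 * real n * p * m * B\<^sup>2) ^ m"
proof -
  define K where "K = B ^ (2 * m) * (n * p / m) ^ m"
  define x where "x = real m / n"
  let ?es = "\<lambda>u w w'. walk_edges (odd m) u w @ walk_edges (odd m) u w'"
  let ?E = "\<lambda>u w w'. measure_pmf.expectation (bernoulli_model n p)
        (\<lambda>\<delta>. prod_list (map (\<lambda>e. (of_bool (\<delta> e) - p) * X (fst e) (snd e)) (?es u w w')))"
  have K: "0 \<le> K" using p X[of 0 0] n by (auto simp: K_def)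
  have "measure_pmf.expectation (bernoulli_model n p)
        (\<lambda>\<delta>. alt_frobenius n m (\<lambda>e. (of_bool (\<delta> e) - p) * X (fst e) (snd e)))
      = (\<Sum>u<n. \<Sum>v<n. \<Sum>w\<in>walks n m. \<Sum>w'\<in>walks n m.
          of_bool (last (u # w) = v \<and> last (u # w') = v) * ?E u w w')"
    unfolding alt_frobenius_eq_sum_walk_pairs
    by (simp add: Bochner_Integration.integral_sum del: map_append last.simps)
  \<comment> \<open>The expectation does not depend on \<open>v\<close>, so the sum over
    \<open>v\<close> only counts common endpoints, of which there is at most one.\<close>
  also have "\<dots> = (\<Sum>u<n. \<Sum>w\<in>walks n m. \<Sum>w'\<in>walks n m.
      (\<Sum>v<n. of_bool (last (u # w) = v \<and> last (u # w') = v)) * ?E u w w')"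
    unfolding sum_distrib_right
    by (rule sum.cong[OF refl], subst sum.swap, rule sum.cong[OF refl], rule sum.swap)
  also have "\<dots> \<le> (\<Sum>u<n. \<Sum>w\<in>walks n m. \<Sum>w'\<in>walks n m. K * x ^ card (set (?es u w w')))"
  proof (intro sum_mono)
    fix u w w'
    assume u: "u \<in> {..<n}" and w: "w \<in> walks n m" and w': "w' \<in> walks n m"
    have "(\<Sum>v<n. of_bool (last (u # w) = v \<and> last (u # w') = v)) \<le> (\<Sum>v<n. of_bool (last (u # w) = v) :: real)"
      by (intro sum_mono) auto
    also have "\<dots> \<le> 1" by (simp add: of_bool_def)
    finally have le1: "(\<Sum>v<n. of_bool (last (u # w) = v \<and> last (u # w') = v)) \<le> (1 :: real)" .
    have "(\<Sum>v<n. of_bool (last (u # w) = v \<and> last (u # w') = v)) * ?E u w w'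
        \<le> (\<Sum>v<n. of_bool (last (u # w) = v \<and> last (u # w') = v)) * \<bar>?E u w w'\<bar>"
      by (intro mult_left_mono abs_ge_self sum_nonneg) auto
    also have "\<dots> \<le> 1 * \<bar>?E u w w'\<bar>"
      by (intro mult_right_mono le1) auto
    also have "\<dots> \<le> K * x ^ card (set (?es u w w'))"
      unfolding K_def x_def mult_1
      by (rule abs_expectation_walk_pair_le[OF p m n X])
         (use u w w' set_walk_edges[of u n] in \<open>auto simp: walks_def\<close>)
    finally show "(\<Sum>v<n. of_bool (last (u # w) = v \<and> last (u # w') = v)) * ?E u w w'
        \<le> K * x ^ card (set (?es u w w'))" .
  qed
  also have "\<dots> \<le> (\<Sum>u<n. K * (n * x + real (2 * m)) ^ (2 * m))"
    unfolding sum_distrib_left[symmetric]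
    by (intro mult_left_mono[OF _ K] sum_mono) (rule sum_walk_pairs_power_card_le, simp add: x_def)
  \<comment> \<open>Since \<open>x = m / n\<close>, the base \<open>n * x + 2 * m\<close> equals
    \<open>3 * m\<close>.\<close>
  also have "\<dots> = n * (K * (3 * real m) ^ (2 * m))"
    using n by (simp add: x_def)
  also have "K * (3 * real m) ^ (2 * m) = (9 * real n * p * m * B\<^sup>2) ^ m"
  proof -
    have "K * (3 * real m) ^ (2 * m) = (B\<^sup>2 * (n * p / m) * (3 * real m)\<^sup>2) ^ m"
      by (simp only: K_def power_mult power_mult_distrib)
    also have "B\<^sup>2 * (n * p / m) * (3 * real m)\<^sup>2 = 9 * real n * p * m * B\<^sup>2"
      using m by (simp add: field_simps power2_eq_square)
    finally show ?thesis .
  qed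
  finally show ?thesis .
qed

section \<open>Tail bound and choice of the moment order\<close>

text \<open>Exceeding \<open>r\<close> forces the squared Frobenius norm above
  \<open>(r\<^sup>2) ^ m\<close>, an event controlled by Markov's inequality.\<close>

lemma prob_spec_norm_gt_le:
  fixes p B r :: real
  assumes p: "0 < p" "p \<le> 1" and m: "0 < m" "m \<le> n * p" and n: "0 < n" and r: "0 < r"
    and X: "\<And>i j. i < n \<Longrightarrow> j < n \<Longrightarrow> \<bar>X i j\<bar> \<le> B"
  shows "measure_pmf.prob (bernoulli_model n p)
        {\<delta>. \<not> spec_norm n (\<lambda>a b. P_Omega \<delta> X a b - p * X a b) \<le> r}
    \<le> n * (9 * real n * p * m * B\<^sup>2 / r\<^sup>2) ^ m"
proof -
  let ?M = "measure_pmf (bernoulli_model n p)"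
  let ?Z = "\<lambda>\<delta> e. (of_bool (\<delta> e) - p) * X (fst e) (snd e)"
  have eq: "(\<lambda>a b. P_Omega \<delta> X a b - p * X a b) = (\<lambda>a b. ?Z \<delta> (a, b))" for \<delta>
    by (auto simp: P_Omega_def fun_eq_iff algebra_simps)
  have "measure ?M {\<delta>. \<not> spec_norm n (\<lambda>a b. P_Omega \<delta> X a b - p * X a b) \<le> r}
      \<le> measure ?M {\<delta> \<in> space ?M. (r\<^sup>2) ^ m \<le> alt_frobenius n m (?Z \<delta>)}"
  proof (intro measure_pmf.finite_measure_mono subsetI)
    fix \<delta> assume "\<delta> \<in> {\<delta>. \<not> spec_norm n (\<lambda>a b. P_Omega \<delta> X a b - p * X a b) \<le> r}"
    then have "\<not> spec_norm n (\<lambda>a b. ?Z \<delta> (a, b)) \<le> r"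
      unfolding eq by simp
    then have "\<not> alt_frobenius n m (?Z \<delta>) \<le> (r\<^sup>2) ^ m"
      using spec_norm_le_of_alt_frobenius[of r m n "?Z \<delta>"] r m by auto
    then show "\<delta> \<in> {\<delta> \<in> space ?M. (r\<^sup>2) ^ m \<le> alt_frobenius n m (?Z \<delta>)}"
      by simp
  qed simp
  also have "\<dots> \<le> (\<integral>\<delta>. alt_frobenius n m (?Z \<delta>) \<partial>?M) / (r\<^sup>2) ^ m"
    by (rule integral_Markov_inequality_measure[where A = "{}"]) (use r in \<open>auto simp: alt_frobenius_nonneg\<close>)
  also have "\<dots> \<le> n * (9 * real n * p * m * B\<^sup>2) ^ m / (r\<^sup>2) ^ m"
    using expectation_alt_frobenius_le[OF p m n X] r by (intro divide_right_mono) auto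
  finally show ?thesis by (simp add: power_divide)
qed

lemma spec_norm_eq_0:
  assumes "\<And>i j. i < n \<Longrightarrow> j < n \<Longrightarrow> A i j = 0"
  shows "spec_norm n A = 0"
proof -
  have "(\<lambda>x. sqrt (\<Sum>i<n. (\<Sum>j<n. A i j * x j)\<^sup>2)) = (\<lambda>x :: nat \<Rightarrow> real. 0)"
    using assms by simp
  moreover have "{x :: nat \<Rightarrow> real. (\<Sum>j<n. (x j)\<^sup>2) \<le> 1} \<noteq> {}"
    by (auto intro!: exI[of _ "\<lambda>_. 0"])
  ultimately show ?thesis by (simp only: spec_norm_def) (rule cSUP_const)
qed

lemma abs_le_max_norm: "i < n \<Longrightarrow> j < n \<Longrightarrow> \<bar>X i j\<bar> \<le> max_norm n X"
  unfolding max_norm_def by (rule Max_ge) (auto intro!: finite_image_set2)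

lemma nat_floor_bounds:
  fixes x :: real
  assumes "1 \<le> x"
  shows "0 < nat \<lfloor>x\<rfloor>" "nat \<lfloor>x\<rfloor> \<le> x" "x / 2 \<le> nat \<lfloor>x\<rfloor>"
proof -
  have "1 \<le> \<lfloor>x\<rfloor>" using assms by simp
  then show "0 < nat \<lfloor>x\<rfloor>" "nat \<lfloor>x\<rfloor> \<le> x" by auto
  have "1 \<le> real_of_int \<lfloor>x\<rfloor>" using \<open>1 \<le> \<lfloor>x\<rfloor>\<close> by linarith
  moreover have "x < real_of_int \<lfloor>x\<rfloor> + 1" by linarith
  moreover have "real (nat \<lfloor>x\<rfloor>) = real_of_int \<lfloor>x\<rfloor>"
    using \<open>1 \<le> \<lfloor>x\<rfloor>\<close> by simp
  ultimately show "x / 2 \<le> nat \<lfloor>x\<rfloor>" by linarith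
qed

theorem theorem6p1:
  "\<exists>C0 :: real. \<forall>(n :: nat) (p :: real) (\<beta> :: real) (X :: nat \<Rightarrow> nat \<Rightarrow> real).
     n \<ge> 1 \<longrightarrow> 0 < p \<longrightarrow> p \<le> 1 \<longrightarrow> \<beta> > 2 \<longrightarrow> real n * p \<ge> \<beta> * ln (real n) \<longrightarrow>
     measure_pmf.prob (bernoulli_model n p)
       {\<delta>. (1 / p) * spec_norm n (\<lambda>a b. P_Omega \<delta> X a b - p * X a b)
             \<le> C0 * sqrt (\<beta> * real n * ln (real n) / p) * max_norm n X}
     \<ge> 1 - real n powr (- \<beta>)"
proof (intro exI[of _ "3 * exp 2 :: real"] allI impI)
  fix n :: nat and p \<beta> :: real and X :: "nat \<Rightarrow> nat \<Rightarrow> real"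
  assume n: "n \<ge> 1" and p: "0 < p" "p \<le> 1" and \<beta>: "\<beta> > 2" and np: "real n * p \<ge> \<beta> * ln (real n)"
  let ?A = "\<lambda>\<delta> a b. P_Omega \<delta> X a b - p * X a b"
  let ?R = "3 * exp 2 * sqrt (\<beta> * real n * ln (real n) / p) * max_norm n X"
  let ?good = "{\<delta>. (1 / p) * spec_norm n (?A \<delta>) \<le> ?R}"
  let ?P = "measure_pmf.prob (bernoulli_model n p)"
  note X = abs_le_max_norm[of _ n _ X]
  have B0: "0 \<le> max_norm n X" using X[of 0 0] n by simp
  \<comment> \<open>The first two cases would give the threshold 0, excluded in the tail bound. For
    \<open>n = 1\<close> the claimed probability is 0; for a vanishing norm the random matrix is
    zero.\<close>
  consider "n = 1" | "max_norm n X = 0" | "2 \<le> n" "0 < max_norm n X"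
    using n B0 by linarith
  then show "?P ?good \<ge> 1 - real n powr (- \<beta>)"
  proof cases
    case 1
    then show ?thesis by simp
  next
    case 2
    then have "X i j = 0" if "i < n" "j < n" for i j
      using X[OF that] by simp
    then have "spec_norm n (?A \<delta>) = 0" for \<delta>
      by (intro spec_norm_eq_0) (simp add: P_Omega_def)
    then have "?good = UNIV" using 2 by auto
    then show ?thesis by simp
  next
    case 3
    define l where "l = \<beta> * ln (real n)"
    define m where "m = nat \<lfloor>l\<rfloor>"
    define B where "B = max_norm n X"
    \<comment> \<open>\<open>\<beta> > 2\<close> and \<open>n \<ge> 2\<close> put \<open>l\<close>
      above 1, so its floor \<open>m\<close> is positive and loses at most half of
      \<open>l\<close>.\<close>
    have "ln 2 \<le> ln (real n)" using 3 by simp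
    then have "2 * ln 2 \<le> l"
      unfolding l_def using \<beta> by (intro mult_mono) auto
    then have l1: "1 \<le> l" using ln2_ge_two_thirds by linarith
    have m: "0 < m" "m \<le> l" "l / 2 \<le> m"
      unfolding m_def using nat_floor_bounds[OF l1] by auto
    have npl: "l \<le> n * p" using np by (simp add: l_def)
    \<comment> \<open>The constant \<open>3 * exp 2\<close> is fixed by this threshold: in the tail
      bound its square cancels the factor 9 and leaves at most \<open>exp (-4)\<close> per unit of
      \<open>m\<close>.\<close>
    define r where "r = p * ?R"
    have r2: "r\<^sup>2 = 9 * exp 4 * real n * p * l * B\<^sup>2"
    proof -
      have "r\<^sup>2 = p\<^sup>2 * (9 * (exp 2)\<^sup>2 * (sqrt (n * l / p))\<^sup>2 * B\<^sup>2)"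
        by (simp add: r_def l_def B_def power_mult_distrib mult_ac)
      also have "(exp 2 :: real)\<^sup>2 = exp 4" by (simp add: exp_double[symmetric])
      also have "(sqrt (n * l / p))\<^sup>2 = n * l / p" using l1 p by simp
      finally show ?thesis using p by (simp add: field_simps power2_eq_square)
    qed
    have r: "0 < r"
      using p 3 l1 \<beta> by (simp add: r_def)
    \<comment> \<open>From \<open>m \<ge> l / 2\<close> the left side is at most n^(1 - 2 \<beta>),
      and \<open>\<beta> \<ge> 1\<close> absorbs the leading \<open>n\<close>.\<close>
    have tail: "real n * exp (-4) ^ m \<le> real n powr (- \<beta>)"
    proof -
      have n': "0 < real n" using n by simp
      have "1 * ln n \<le> \<beta> * ln n"
        by (rule mult_right_mono) (use n \<beta> in simp_all)
      then have "ln n + real m * (-4) \<le> - \<beta> * ln n"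
        using m unfolding l_def by linarith
      then have "exp (ln n + real m * (-4)) \<le> exp (- \<beta> * ln n)"
        by (simp only: exp_le_cancel_iff)
      moreover have "exp (ln n + real m * (-4)) = real n * exp (-4) ^ m"
        by (simp only: exp_add exp_of_nat_mult exp_ln[OF n'])
      moreover have "real n powr (- \<beta>) = exp (- \<beta> * ln n)"
        using n' by (simp add: powr_def)
      ultimately show ?thesis by (simp only:)
    qed
    have "?P {\<delta>. \<not> spec_norm n (?A \<delta>) \<le> r} \<le> n * (9 * real n * p * m * B\<^sup>2 / r\<^sup>2) ^ m"
      using 3 m npl X p r unfolding B_def by (intro prob_spec_norm_gt_le) auto
    also have "\<dots> \<le> n * exp (-4) ^ m"
    proof (intro mult_left_mono power_mono)
      have "9 * real n * p * m * B\<^sup>2 \<le> 9 * real n * p * l * B\<^sup>2"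
        using p m by (intro mult_right_mono mult_left_mono) auto
      also have "\<dots> = exp (-4) * r\<^sup>2"
        unfolding r2 by (simp add: exp_minus field_simps)
      finally show "9 * real n * p * m * B\<^sup>2 / r\<^sup>2 \<le> exp (-4)"
        using r by (simp add: field_simps)
    qed (use p in auto)
    also note tail
    finally have bad: "?P {\<delta>. \<not> spec_norm n (?A \<delta>) \<le> r} \<le> real n powr (- \<beta>)" .
    have "?good = UNIV - {\<delta>. \<not> spec_norm n (?A \<delta>) \<le> r}"
      using p by (auto simp: r_def field_simps)
    then have "?P ?good = 1 - ?P {\<delta>. \<not> spec_norm n (?A \<delta>) \<le> r}"
      using measure_pmf.prob_compl[of "{\<delta>. \<not> spec_norm n (?A \<delta>) \<le> r}" "bernoulli_model n p"] by simp
    then show ?thesis using bad by simp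
  qed
qed

end
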